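(* Let $(P,\rho)$ be a weakly ranked locally finite poset, $\kappa$ a $(P,\rho)$-kernel with right and left KLS functions $f,g$, $Z$-function $Z$, and right and left augmented Chow functions $F,G$. Then for all $s\le t$ in $P$, $$F_{st}(x)=Z_{st}(x)+\sum_{s<w\le t}\frac{g^{\mathrm{rev}}_{sw}(x)-xg_{sw}(x)}{x-1}\,F_{wt}(x),\qquad G_{st}(x)=Z_{st}(x)+\sum_{s\le w<t}G_{sw}(x)\,\frac{f^{\mathrm{rev}}_{wt}(x)-xf_{wt}(x)}{x-1}.$$
   Context: $P$ is a locally finite poset; $\operatorname{Int}(P)$ is its set of closed intervals. A weak rank function is a map $\rho:\operatorname{Int}(P)\to\mathbb{Z}_{\ge0}$, $[s,t]\mapsto\rho_{st}$, with $\rho_{st}>0$ whenever $s<t$ and $\rho_{st}=\rho_{sw}+\rho_{wt}$ for $s\le w\le t$. The incidence algebra $\mathcal{I}(P)$ consists of maps $a$ assigning to each $[s,t]$ a polynomial $a_{st}(x)\in\mathbb{Z}[x]$, with product $(ab)_{st}=\sum_{s\le w\le t}a_{sw}b_{wt}$. $\mathcal{I}_\rho(P)=\{a:\deg a_{st}\le\rho_{st}\}$, and $a^{\mathrm{rev}}_{st}(x)=x^{\rho_{st}}a_{st}(x^{-1})$. A $(P,\rho)$-kernel is $\kappa\in\mathcal{I}_\rho(P)$ with $\kappa_{ss}=1$ for all $s$ and $\kappa^{-1}=\kappa^{\mathrm{rev}}$. For $s<t$, $\kappa_{st}$ is divisible by $x-1$; the reduced kernel has $\overline{\kappa}_{st}=\kappa_{st}/(x-1)$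 for $s<t$ and $\overline{\kappa}_{ss}=-1$. The Chow function is $\mathrm{H}=-(\overline{\kappa})^{-1}$. The right KLS function is the unique $f\in\mathcal{I}_\rho(P)$ with $f_{ss}=1$, $\deg f_{st}<\rho_{st}/2$ for $s<t$, $f^{\mathrm{rev}}=\kappa f$; the left KLS function is the unique $g\in\mathcal{I}_\rho(P)$ with $g_{ss}=1$, $\deg g_{st}<\rho_{st}/2$ for $s<t$, $g^{\mathrm{rev}}=g\kappa$. The $Z$-function is $Z=g^{\mathrm{rev}}f$ $(=gf^{\mathrm{rev}})$. The augmented Chow functions are $F=\mathrm{H}f^{\mathrm{rev}}$ and $G=g^{\mathrm{rev}}\mathrm{H}$. *)

theory Defs
  imports "HOL-Computational_Algebra.Polynomial"
begin

definition locally_finite :: "'a::order itself \<Rightarrow> bool" where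
  "locally_finite _ \<longleftrightarrow> (\<forall>s t :: 'a. finite {s..t})"

text \<open>A function on closed intervals is given as a binary function of the end points; the values of
  a weak rank function at pairs that are not intervals play no role.\<close>

definition weak_rank_function :: "('a::order \<Rightarrow> 'a \<Rightarrow> nat) \<Rightarrow> bool" where
  "weak_rank_function \<rho> \<longleftrightarrow>
     (\<forall>s t. s < t \<longrightarrow> 0 < \<rho> s t) \<and>
     (\<forall>s w t. s \<le> w \<longrightarrow> w \<le> t \<longrightarrow> \<rho> s t = \<rho> s w + \<rho> w t)"

text \<open>Elements of the incidence algebra are extended by zero to pairs that are not intervals, so
  that equality of functions is equality in the incidence algebra.\<close>

type_synonym 'a incidence = "'a \<Rightarrow> 'a \<Rightarrow> int poly"

definition incidence_algebra :: "'a::order incidence set" where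
  "incidence_algebra = {a. \<forall>s t. \<not> s \<le> t \<longrightarrow> a s t = 0}"

definition inc_mult :: "'a::order incidence \<Rightarrow> 'a incidence \<Rightarrow> 'a incidence" where
  "inc_mult a b = (\<lambda>s t. \<Sum>w\<in>{s..t}. a s w * b w t)"

definition inc_one :: "'a::order incidence" where
  "inc_one = (\<lambda>s t. if s = t then 1 else 0)"

definition is_inc_inverse :: "'a::order incidence \<Rightarrow> 'a incidence \<Rightarrow> bool" where
  "is_inc_inverse a b \<longleftrightarrow>
     b \<in> incidence_algebra \<and> inc_mult a b = inc_one \<and> inc_mult b a = inc_one"

text \<open>Over a locally finite poset two-sided inverses are unique, and exist whenever all diagonal
  entries are units.\<close>

definition inc_inverse :: "'a::order incidence \<Rightarrow> 'a incidence" where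
  "inc_inverse a = (THE b. is_inc_inverse a b)"

definition ranked_incidence_algebra :: "('a::order \<Rightarrow> 'a \<Rightarrow> nat) \<Rightarrow> 'a incidence set" where
  "ranked_incidence_algebra \<rho> =
     {a \<in> incidence_algebra. \<forall>s t. s \<le> t \<longrightarrow> degree (a s t) \<le> \<rho> s t}"

text \<open>For \<open>deg a\<^sub>s\<^sub>t \<le> \<rho>\<^sub>s\<^sub>t\<close> the following polynomial is \<open>x^\<rho>\<^sub>s\<^sub>t a\<^sub>s\<^sub>t(1/x)\<close>; see
  \<open>poly_inc_rev\<close> below. It is only used for such \<open>a\<close>.\<close>

definition inc_rev :: "('a::order \<Rightarrow> 'a \<Rightarrow> nat) \<Rightarrow> 'a incidence \<Rightarrow> 'a incidence" where
  "inc_rev \<rho> a = (\<lambda>s t. \<Sum>i\<le>\<rho> s t. monom (coeff (a s t) i) (\<rho> s t - i))"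

definition kernel :: "('a::order \<Rightarrow> 'a \<Rightarrow> nat) \<Rightarrow> 'a incidence \<Rightarrow> bool" where
  "kernel \<rho> \<kappa> \<longleftrightarrow>
     \<kappa> \<in> ranked_incidence_algebra \<rho> \<and> (\<forall>s. \<kappa> s s = 1) \<and> is_inc_inverse \<kappa> (inc_rev \<rho> \<kappa>)"

text \<open>The division by \<open>x - 1\<close> is exact when \<open>\<kappa>\<close> is a kernel; see \<open>kernel_dvd\<close> below.\<close>

definition reduced_kernel :: "'a::order incidence \<Rightarrow> 'a incidence" where
  "reduced_kernel \<kappa> = (\<lambda>s t. if s = t then -1 else \<kappa> s t div [:-1, 1:])"

definition chow_function :: "'a::order incidence \<Rightarrow> 'a incidence" where
  "chow_function \<kappa> = (\<lambda>s t. - inc_inverse (reduced_kernel \<kappa>) s t)"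

definition right_KLS :: "('a::order \<Rightarrow> 'a \<Rightarrow> nat) \<Rightarrow> 'a incidence \<Rightarrow> 'a incidence \<Rightarrow> bool" where
  "right_KLS \<rho> \<kappa> f \<longleftrightarrow>
     f \<in> ranked_incidence_algebra \<rho> \<and> (\<forall>s. f s s = 1) \<and>
     (\<forall>s t. s < t \<longrightarrow> 2 * degree (f s t) < \<rho> s t) \<and> inc_rev \<rho> f = inc_mult \<kappa> f"

definition left_KLS :: "('a::order \<Rightarrow> 'a \<Rightarrow> nat) \<Rightarrow> 'a incidence \<Rightarrow> 'a incidence \<Rightarrow> bool" where
  "left_KLS \<rho> \<kappa> g \<longleftrightarrow>
     g \<in> ranked_incidence_algebra \<rho> \<and> (\<forall>s. g s s = 1) \<and>
     (\<forall>s t. s < t \<longrightarrow> 2 * degree (g s t) < \<rho> s t) \<and> inc_rev \<rho> g = inc_mult g \<kappa>"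

definition Z_function ::
    "('a::order \<Rightarrow> 'a \<Rightarrow> nat) \<Rightarrow> 'a incidence \<Rightarrow> 'a incidence \<Rightarrow> 'a incidence" where
  "Z_function \<rho> f g = inc_mult (inc_rev \<rho> g) f"

definition right_augmented_chow ::
    "('a::order \<Rightarrow> 'a \<Rightarrow> nat) \<Rightarrow> 'a incidence \<Rightarrow> 'a incidence \<Rightarrow> 'a incidence" where
  "right_augmented_chow \<rho> \<kappa> f = inc_mult (chow_function \<kappa>) (inc_rev \<rho> f)"

definition left_augmented_chow ::
    "('a::order \<Rightarrow> 'a \<Rightarrow> nat) \<Rightarrow> 'a incidence \<Rightarrow> 'a incidence \<Rightarrow> 'a incidence" where
  "left_augmented_chow \<rho> \<kappa> g = inc_mult (inc_rev \<rho> g) (chow_function \<kappa>)"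

lemma poly_inc_rev:
  fixes x :: "'b::field_char_0"
  assumes "degree (a s t) \<le> \<rho> s t" "x \<noteq> 0"
  shows "poly (map_poly of_int (inc_rev \<rho> a s t)) x =
         x ^ \<rho> s t * poly (map_poly of_int (a s t)) (1 / x)"
proof -
  have map_sum: "map_poly (of_int :: int \<Rightarrow> 'b) (sum p A) = (\<Sum>i\<in>A. map_poly of_int (p i))"
    for p :: "nat \<Rightarrow> int poly" and A
    by (rule poly_eqI) (simp add: coeff_map_poly coeff_sum)
  have map_monom: "map_poly (of_int :: int \<Rightarrow> 'b) (monom c n) = monom (of_int c) n" for c n
    by (rule poly_eqI) (simp add: coeff_map_poly)
  have "poly (map_poly of_int (a s t)) (1 / x) =
        (\<Sum>i\<le>\<rho> s t. of_int (coeff (a s t) i) * (1 / x) ^ i)"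
    unfolding poly_altdef
    by (intro sum.mono_neutral_cong_left)
      (use assms in \<open>auto simp: coeff_map_poly coeff_eq_0 degree_map_poly\<close>)
  then have "x ^ \<rho> s t * poly (map_poly of_int (a s t)) (1 / x) =
             (\<Sum>i\<le>\<rho> s t. x ^ \<rho> s t * (of_int (coeff (a s t) i) * (1 / x) ^ i))"
    by (simp only: sum_distrib_left)
  also have "\<dots> = (\<Sum>i\<le>\<rho> s t. of_int (coeff (a s t) i) * x ^ (\<rho> s t - i))"
    by (rule sum.cong) (use \<open>x \<noteq> 0\<close> in \<open>auto simp: power_diff power_one_over field_simps\<close>)
  finally show ?thesis
    by (simp add: inc_rev_def map_sum map_monom poly_sum poly_monom)
qed

lemma poly_inc_rev_1:
  assumes "degree (a s t) \<le> \<rho> s t"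
  shows "poly (inc_rev \<rho> a s t) 1 = poly (a s t) 1"
proof -
  have "(\<Sum>i\<le>\<rho> s t. coeff (a s t) i) = (\<Sum>i\<le>degree (a s t). coeff (a s t) i)"
    by (rule sum.mono_neutral_right) (use assms in \<open>auto simp: coeff_eq_0\<close>)
  then show ?thesis
    by (simp add: inc_rev_def poly_sum poly_monom poly_altdef[of "a s t"])
qed

lemma kernel_dvd:
  fixes \<rho> :: "'a::order \<Rightarrow> 'a \<Rightarrow> nat"
  assumes fin: "locally_finite TYPE('a)" and ker: "kernel \<rho> \<kappa>" and "s < t"
  shows "[:-1, 1:] dvd \<kappa> s t"
proof -
  have fin': "finite {u..v}" for u v :: 'a
    using fin by (simp add: locally_finite_def)
  have rev1: "poly (inc_rev \<rho> \<kappa> u v) 1 = poly (\<kappa> u v) 1" if "u \<le> v" for u v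
    using ker that by (intro poly_inc_rev_1) (auto simp: kernel_def ranked_incidence_algebra_def)
  have diag: "\<kappa> u u = 1" for u
    using ker by (simp add: kernel_def)
  have "poly (\<kappa> s t) 1 = 0"
    using \<open>s < t\<close>
  proof (induction "card {s..t}" arbitrary: s t rule: less_induct)
    case less
    have IH: "poly (\<kappa> s w) 1 = 0" if "s < w" "w < t" for w
    proof (rule less.hyps)
      show "card {s..w} < card {s..t}"
        by (rule psubset_card_mono[OF fin']) (use that less.prems in \<open>auto simp: less_le_not_le\<close>)
    qed fact
    have "inc_mult \<kappa> (inc_rev \<rho> \<kappa>) s t = 0"
      using ker less.prems by (simp add: kernel_def is_inc_inverse_def inc_one_def)
    then have "0 = (\<Sum>w\<in>{s..t}. poly (\<kappa> s w) 1 * poly (inc_rev \<rho> \<kappa> w t) 1)"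
      by (metis (no_types, lifting) inc_mult_def poly_0 poly_mult poly_sum sum.cong)
    also have "\<dots> = (\<Sum>w\<in>{s..t}. poly (\<kappa> s w) 1 * poly (\<kappa> w t) 1)"
      by (intro sum.cong) (auto simp: rev1)
    also have "\<dots> = (\<Sum>w\<in>{s,t}. poly (\<kappa> s w) 1 * poly (\<kappa> w t) 1)"
      by (rule sum.mono_neutral_right[OF fin']) (use less.prems IH in \<open>auto simp: less_le\<close>)
    also have "\<dots> = 2 * poly (\<kappa> s t) 1"
      using less.prems by (auto simp: diag)
    finally show ?case by simp
  qed
  then show ?thesis
    by (simp add: poly_eq_0_iff_dvd)
qed

text \<open>Hence the quotients \<open>(g\<^sup>r\<^sup>e\<^sup>v - x g) / (x - 1)\<close> of the theorem are also exact.\<close>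

lemma inc_rev_minus_dvd:
  assumes "a \<in> ranked_incidence_algebra \<rho>" "s \<le> t"
  shows "[:-1, 1:] dvd inc_rev \<rho> a s t - [:0, 1:] * a s t"
proof -
  have "poly (inc_rev \<rho> a s t - [:0, 1:] * a s t) 1 = 0"
    using poly_inc_rev_1[of a s t \<rho>] assms by (simp add: ranked_incidence_algebra_def)
  then show ?thesis
    by (simp only: poly_eq_0_iff_dvd)
qed

end

theory Submission
  imports Defs
begin

text \<open>Since \<open>(x - 1) \<kappa>\<^sub>r = \<kappa> - x\<close> for the reduced kernel \<open>\<kappa>\<^sub>r\<close>, the quotient
  \<open>(g\<^sup>r\<^sup>e\<^sup>v - x g) / (x - 1)\<close> is the incidence algebra product \<open>g \<kappa>\<^sub>r\<close>. Its diagonal entries are \<open>-1\<close>, so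
  the formula for \<open>F\<close> says that \<open>Z + (g \<kappa>\<^sub>r) F = 0\<close>. Indeed, as \<open>\<kappa>\<^sub>r H = -1\<close>,
  \<open>(g \<kappa>\<^sub>r) (H f\<^sup>r\<^sup>e\<^sup>v) = - g f\<^sup>r\<^sup>e\<^sup>v = - g \<kappa> f = - Z\<close>. The formula for \<open>G\<close> is dual.\<close>

section \<open>The incidence algebra: product, unit and end terms\<close>

lemma locally_finiteD: "locally_finite TYPE('a::order) \<Longrightarrow> finite {s..t::'a}"
  by (simp add: locally_finite_def)

lemma inc_mult_in_incidence_algebra [simp]: "inc_mult a b \<in> incidence_algebra"
  by (auto simp: incidence_algebra_def inc_mult_def)

text \<open>Both sides sum over the chains \<open>s \<le> w \<le> v \<le> t\<close>; only the order
  of summation differs, and it may be exchanged because intervals are finite.\<close>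

lemma inc_mult_assoc:
  fixes a b c :: "'a::order incidence"
  assumes "locally_finite TYPE('a)"
  shows "inc_mult (inc_mult a b) c = inc_mult a (inc_mult b c)"
proof (intro ext)
  fix s t :: 'a
  have "inc_mult (inc_mult a b) c s t =
        (\<Sum>v\<in>{s..t}. \<Sum>w\<in>{w \<in> {s..t}. w \<le> v}. a s w * b w v * c v t)"
    unfolding inc_mult_def sum_distrib_right
    by (intro sum.cong refl) (auto intro: order_trans)
  also have "\<dots> = (\<Sum>w\<in>{s..t}. \<Sum>v\<in>{v \<in> {s..t}. w \<le> v}. a s w * b w v * c v t)"
    by (rule sum.swap_restrict) (simp_all add: locally_finiteD[OF assms])
  also have "\<dots> = inc_mult a (inc_mult b c) s t"
    unfolding inc_mult_def sum_distrib_left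
    by (intro sum.cong refl) (auto intro: order_trans simp: mult.assoc)
  finally show "inc_mult (inc_mult a b) c s t = inc_mult a (inc_mult b c) s t" .
qed

lemma inc_mult_one_left:
  fixes a :: "'a::order incidence"
  assumes "locally_finite TYPE('a)" "a \<in> incidence_algebra"
  shows "inc_mult inc_one a = a"
proof (intro ext)
  fix s t :: 'a
  have "inc_mult inc_one a s t = (\<Sum>w\<in>{s..t}. if s = w then a w t else 0)"
    unfolding inc_mult_def inc_one_def by (intro sum.cong) auto
  also have "\<dots> = a s t"
    using assms by (auto simp: locally_finiteD incidence_algebra_def)
  finally show "inc_mult inc_one a s t = a s t" .
qed

lemma inc_mult_one_right:
  fixes a :: "'a::order incidence"
  assumes "locally_finite TYPE('a)" "a \<in> incidence_algebra"
  shows "inc_mult a inc_one = a"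
proof (intro ext)
  fix s t :: 'a
  have "inc_mult a inc_one s t = (\<Sum>w\<in>{s..t}. if w = t then a s w else 0)"
    unfolding inc_mult_def inc_one_def by (intro sum.cong) auto
  also have "\<dots> = a s t"
    using assms by (auto simp: locally_finiteD incidence_algebra_def)
  finally show "inc_mult a inc_one s t = a s t" .
qed

lemma inc_mult_minus_left: "inc_mult (\<lambda>s t. - a s t) b s t = - inc_mult a b s t"
  by (simp add: inc_mult_def sum_negf)

lemma inc_mult_minus_right: "inc_mult a (\<lambda>s t. - b s t) s t = - inc_mult a b s t"
  by (simp add: inc_mult_def sum_negf)

text \<open>Isolates the diagonal entry of \<open>a\<close>: it serves to solve an equation of
  products for \<open>b s t\<close>, first to construct inverses and later to extract the recursion
  for \<open>F\<close>.\<close>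

lemma inc_mult_split_left:
  fixes a b :: "'a::order incidence"
  assumes "locally_finite TYPE('a)" "s \<le> t"
  shows "inc_mult a b s t = a s s * b s t + (\<Sum>w\<in>{s<..t}. a s w * b w t)"
proof -
  have "{s..t} = insert s {s<..t}"
    using \<open>s \<le> t\<close> by (auto simp: less_le)
  then show ?thesis
    using locally_finiteD[OF assms(1), of s t] by (simp add: inc_mult_def)
qed

lemma inc_mult_split_right:
  fixes a b :: "'a::order incidence"
  assumes "locally_finite TYPE('a)" "s \<le> t"
  shows "inc_mult a b s t = a s t * b t t + (\<Sum>w\<in>{s..<t}. a s w * b w t)"
proof -
  have "{s..t} = insert t {s..<t}"
    using \<open>s \<le> t\<close> by (auto simp: less_le)
  then show ?thesis
    using locally_finiteD[OF assms(1), of s t] by (simp add: inc_mult_def)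
qed

section \<open>Inverses in the incidence algebra\<close>

text \<open>As \<open>a s s\<close> is a unit, the entry of \<open>inc_mult a b = inc_one\<close> at
  \<open>s\<close>, \<open>t\<close> determines \<open>b s t\<close> from the \<open>b w t\<close>
  with \<open>s < w \<le> t\<close>, that is, from smaller intervals.\<close>

lemma inc_right_inverse_exists:
  fixes a :: "'a::order incidence"
  assumes fin: "locally_finite TYPE('a)" and unit: "\<And>s. a s s dvd 1"
  obtains b where "b \<in> incidence_algebra" "inc_mult a b = inc_one"
proof -
  obtain u where u: "a s s * u s = 1" for s
    using unit unfolding dvd_def by metis
  \<comment> \<open>The equation solved for \<open>b s t\<close>. Pairs serve as arguments so that
    the recursion runs over one well-founded relation; the value 0 off intervals keeps the result in
    the incidence algebra.\<close>
  define step where "step b = (\<lambda>(s, t). if s \<le> t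
      then u s * (inc_one s t - (\<Sum>w\<in>{s<..t}. a s w * b (w, t))) else 0)" for b
  have smaller: "card {w..t} < card {s..t}" if "s < w" "w \<le> t" for s w t :: 'a
    by (rule psubset_card_mono[OF locally_finiteD[OF fin]])
      (use that in \<open>auto simp: less_le_not_le intro: order_trans\<close>)
  have "\<exists>b. \<forall>p. b p = step b p"
  \<comment> \<open>A fixed point of \<open>step\<close> exists because \<open>step b p\<close>
    depends only on \<open>b\<close> at intervals with fewer elements than \<open>p\<close>.\<close>
  proof (rule dependent_wf_choice[of "measure (\<lambda>(s, t). card {s..t})" "\<lambda>b p r. r = step b p"])
    fix b b' :: "'a \<times> 'a \<Rightarrow> int poly" and p r
    assume "\<And>q. (q, p) \<in> measure (\<lambda>(s, t). card {s..t}) \<Longrightarrow> b q = b' q"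
    then have "step b p = step b' p"
      by (cases p) (auto simp: step_def smaller intro!: sum.cong)
    then show "(r = step b p) = (r = step b' p)"
      by simp
  qed auto
  then obtain b where b: "\<And>p. b p = step b p"
    by blast
  show ?thesis
  proof
    show alg: "(\<lambda>s t. b (s, t)) \<in> incidence_algebra"
      by (subst b) (simp add: incidence_algebra_def step_def)
    show "inc_mult a (\<lambda>s t. b (s, t)) = inc_one"
    proof (intro ext)
      fix s t :: 'a
      show "inc_mult a (\<lambda>s t. b (s, t)) s t = inc_one s t"
      proof (cases "s \<le> t")
        case True
        then have "a s s * b (s, t) =
            a s s * u s * (inc_one s t - (\<Sum>w\<in>{s<..t}. a s w * b (w, t)))"
          by (subst b) (simp add: step_def mult.assoc)
        then show ?thesis
          using True by (simp add: inc_mult_split_left[OF fin] u)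
      qed (auto simp: inc_mult_def inc_one_def)
    qed
  qed
qed

text \<open>A right inverse \<open>b\<close> of \<open>a\<close> has unit diagonal entries, hence itself a right inverse, which
  must be \<open>a\<close>.\<close>

lemma is_inc_inverse_exists:
  fixes a :: "'a::order incidence"
  assumes fin: "locally_finite TYPE('a)" and alg: "a \<in> incidence_algebra"
    and unit: "\<And>s. a s s dvd 1"
  obtains b where "is_inc_inverse a b"
proof -
  obtain b where b: "b \<in> incidence_algebra" "inc_mult a b = inc_one"
    using inc_right_inverse_exists[OF fin unit] .
  have "b s s dvd 1" for s
  proof -
    have "a s s * b s s = 1"
      using fun_cong[OF fun_cong[OF b(2)], of s s] by (simp add: inc_mult_def inc_one_def)
    then show ?thesis
      by (metis dvd_triv_right)
  qed
  then obtain c where c: "c \<in> incidence_algebra" "inc_mult b c = inc_one"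
    using inc_right_inverse_exists[OF fin] by blast
  have "a = inc_mult a (inc_mult b c)"
    by (simp add: c(2) inc_mult_one_right[OF fin alg])
  also have "\<dots> = c"
    by (simp add: b(2) inc_mult_one_left[OF fin c(1)] flip: inc_mult_assoc[OF fin])
  finally show ?thesis
    using that b c by (simp add: is_inc_inverse_def)
qed

lemma is_inc_inverse_unique:
  fixes a :: "'a::order incidence"
  assumes fin: "locally_finite TYPE('a)" and b: "is_inc_inverse a b" and c: "is_inc_inverse a c"
  shows "b = c"
proof -
  have "b = inc_mult b (inc_mult a c)"
    using b c by (simp add: is_inc_inverse_def inc_mult_one_right[OF fin])
  also have "\<dots> = inc_mult (inc_mult b a) c"
    by (simp only: inc_mult_assoc[OF fin])
  also have "\<dots> = c"
    using b c by (simp add: is_inc_inverse_def inc_mult_one_left[OF fin])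
  finally show ?thesis .
qed

text \<open>Existence and uniqueness together make the definite description in
  \<open>inc_inverse\<close> meaningful.\<close>

lemma is_inc_inverse_inc_inverse:
  fixes a :: "'a::order incidence"
  assumes "locally_finite TYPE('a)" "a \<in> incidence_algebra" "\<And>s. a s s dvd 1"
  shows "is_inc_inverse a (inc_inverse a)"
proof -
  obtain b where b: "is_inc_inverse a b"
    using is_inc_inverse_exists[OF assms] .
  then show ?thesis
    unfolding inc_inverse_def by (rule theI[where a = b]) (rule is_inc_inverse_unique[OF assms(1) _ b])
qed

section \<open>The reduced kernel and its products\<close>

lemma reduced_kernel_diag [simp]: "reduced_kernel \<kappa> s s = -1"
  by (simp add: reduced_kernel_def)

lemma kernel_in_incidence_algebra: "kernel \<rho> \<kappa> \<Longrightarrow> \<kappa> \<in> incidence_algebra"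
  by (simp add: kernel_def ranked_incidence_algebra_def)

lemma kernel_inverse_reduced_kernel:
  fixes \<kappa> :: "'a::order incidence"
  assumes "locally_finite TYPE('a)" "kernel \<rho> \<kappa>"
  shows "is_inc_inverse (reduced_kernel \<kappa>) (inc_inverse (reduced_kernel \<kappa>))"
  using assms kernel_in_incidence_algebra[OF assms(2)]
  by (intro is_inc_inverse_inc_inverse) (auto simp: incidence_algebra_def reduced_kernel_def)

text \<open>The convention \<open>-1\<close> on the diagonal fits, since
  \<open>-(x - 1) = 1 - x\<close>; above the diagonal the division is exact, and off intervals both
  sides vanish.\<close>

lemma reduced_kernel_times_x_minus_1:
  fixes \<kappa> :: "'a::order incidence"
  assumes "locally_finite TYPE('a)" "kernel \<rho> \<kappa>"
  shows "[:-1, 1:] * reduced_kernel \<kappa> s t = \<kappa> s t - [:0, 1:] * inc_one s t"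
proof -
  consider "s = t" | "s < t" | "s \<noteq> t" "\<not> s \<le> t"
    by (auto simp: less_le)
  then show ?thesis
  proof cases
    case 1
    then show ?thesis
      using assms(2) by (simp add: kernel_def inc_one_def one_pCons)
  next
    case 2
    then have "reduced_kernel \<kappa> s t = \<kappa> s t div [:-1, 1:]" "inc_one s t = 0"
      by (auto simp: reduced_kernel_def inc_one_def)
    then show ?thesis
      by (simp only: dvd_mult_div_cancel[OF kernel_dvd[OF assms 2]] mult_zero_right diff_zero)
  next
    case 3
    then show ?thesis
      using kernel_in_incidence_algebra[OF assms(2)]
      by (simp add: reduced_kernel_def inc_one_def incidence_algebra_def)
  qed
qed

text \<open>Multiplying by \<open>x - 1\<close> turns the reduced kernel into
  \<open>\<kappa> - x\<close> inside the sum; the nonzero factor is then cancelled. For a left KLS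
  function \<open>g\<close> the right-hand side is the coefficient in the formula for
  \<open>F\<close>.\<close>

lemma inc_mult_reduced_kernel_right:
  fixes \<kappa> g :: "'a::order incidence"
  assumes fin: "locally_finite TYPE('a)" and ker: "kernel \<rho> \<kappa>" and g: "g \<in> incidence_algebra"
  shows "inc_mult g (reduced_kernel \<kappa>) s t = (inc_mult g \<kappa> s t - [:0, 1:] * g s t) div [:-1, 1:]"
proof -
  have "[:-1, 1:] * inc_mult g (reduced_kernel \<kappa>) s t =
        (\<Sum>w\<in>{s..t}. g s w * ([:-1, 1:] * reduced_kernel \<kappa> w t))"
    unfolding inc_mult_def sum_distrib_left by (intro sum.cong refl mult.left_commute)
  also have "\<dots> = inc_mult g \<kappa> s t - [:0, 1:] * inc_mult g inc_one s t"
    unfolding reduced_kernel_times_x_minus_1[OF fin ker] inc_mult_def sum_distrib_left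
      sum_subtractf[symmetric]
    by (intro sum.cong refl) (simp only: right_diff_distrib mult.left_commute)
  finally show ?thesis
    unfolding inc_mult_one_right[OF fin g]
    by (metis nonzero_mult_div_cancel_left one_neq_zero pCons_eq_0_iff)
qed

lemma inc_mult_reduced_kernel_left:
  fixes \<kappa> f :: "'a::order incidence"
  assumes fin: "locally_finite TYPE('a)" and ker: "kernel \<rho> \<kappa>" and f: "f \<in> incidence_algebra"
  shows "inc_mult (reduced_kernel \<kappa>) f s t = (inc_mult \<kappa> f s t - [:0, 1:] * f s t) div [:-1, 1:]"
proof -
  have "[:-1, 1:] * inc_mult (reduced_kernel \<kappa>) f s t =
        (\<Sum>w\<in>{s..t}. [:-1, 1:] * reduced_kernel \<kappa> s w * f w t)"
    unfolding inc_mult_def sum_distrib_left by (intro sum.cong refl mult.assoc[symmetric])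
  also have "\<dots> = inc_mult \<kappa> f s t - [:0, 1:] * inc_mult inc_one f s t"
    unfolding reduced_kernel_times_x_minus_1[OF fin ker] inc_mult_def sum_distrib_left
      sum_subtractf[symmetric]
    by (intro sum.cong refl) (simp only: left_diff_distrib mult.assoc)
  finally show ?thesis
    unfolding inc_mult_one_left[OF fin f]
    by (metis nonzero_mult_div_cancel_left one_neq_zero pCons_eq_0_iff)
qed

theorem theorem3p16:
  fixes \<rho> :: "'a::order \<Rightarrow> 'a \<Rightarrow> nat"
    and \<kappa> f g Z F G :: "'a incidence"
    and s t :: 'a
  assumes "locally_finite TYPE('a)"
    and "weak_rank_function \<rho>"
    and "kernel \<rho> \<kappa>"
    and "right_KLS \<rho> \<kappa> f"
    and "left_KLS \<rho> \<kappa> g"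
    and "Z = Z_function \<rho> f g"
    and "F = right_augmented_chow \<rho> \<kappa> f"
    and "G = left_augmented_chow \<rho> \<kappa> g"
    and "s \<le> t"
  shows "F s t = Z s t +
           (\<Sum>w\<in>{s<..t}. ((inc_rev \<rho> g s w - [:0, 1:] * g s w) div [:-1, 1:]) * F w t)
       \<and> G s t = Z s t +
           (\<Sum>w\<in>{s..<t}. G s w * ((inc_rev \<rho> f w t - [:0, 1:] * f w t) div [:-1, 1:]))"
proof
  let ?r = "reduced_kernel \<kappa>"
  define K where "K = inc_inverse ?r"
  note fin = assms(1) and ker = assms(3) and assoc = inc_mult_assoc[OF assms(1)]
  have f: "f \<in> incidence_algebra" "\<And>s. f s s = 1" "inc_rev \<rho> f = inc_mult \<kappa> f"
    using assms(4) by (auto simp: right_KLS_def ranked_incidence_algebra_def)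
  have g: "g \<in> incidence_algebra" "\<And>s. g s s = 1" "inc_rev \<rho> g = inc_mult g \<kappa>"
    using assms(5) by (auto simp: left_KLS_def ranked_incidence_algebra_def)
  have K: "inc_mult ?r K = inc_one" "inc_mult K ?r = inc_one"
    using kernel_inverse_reduced_kernel[OF fin ker] by (simp_all add: is_inc_inverse_def K_def)
  have H: "chow_function \<kappa> = (\<lambda>s t. - K s t)"
    by (simp add: chow_function_def K_def)
  have F: "F = (\<lambda>s t. - inc_mult K (inc_mult \<kappa> f) s t)"
    by (simp add: assms(7) right_augmented_chow_def H f(3) inc_mult_minus_left fun_eq_iff)
  have G: "G = (\<lambda>s t. - inc_mult (inc_mult g \<kappa>) K s t)"
    by (simp add: assms(8) left_augmented_chow_def H g(3) inc_mult_minus_right fun_eq_iff)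
  have Z: "Z = inc_mult (inc_mult g \<kappa>) f"
    by (simp add: assms(6) Z_function_def g(3))
  \<comment> \<open>These entries turn the end terms of the split products into
    \<open>- F s t\<close> and \<open>- G s t\<close>.\<close>
  have diag: "inc_mult g ?r s s = -1" "inc_mult ?r f t t = -1"
    by (simp_all add: inc_mult_def f(2) g(2))

  \<comment> \<open>Regrouping brings \<open>?r\<close> next to its inverse \<open>K\<close>; what
    remains is \<open>g (\<kappa> f)\<close>, which is \<open>Z\<close>, and the sign comes from
    \<open>F\<close>.\<close>
  have "inc_mult (inc_mult g ?r) (inc_mult K (inc_mult \<kappa> f)) =
      inc_mult g (inc_mult (inc_mult ?r K) (inc_mult \<kappa> f))"
    by (simp only: assoc)
  then have "inc_mult (inc_mult g ?r) F s t = - Z s t"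
    by (simp add: F Z inc_mult_minus_right K inc_mult_one_left[OF fin] assoc[of g \<kappa> f])
  then have "F s t = Z s t + (\<Sum>w\<in>{s<..t}. inc_mult g ?r s w * F w t)"
    unfolding inc_mult_split_left[OF fin \<open>s \<le> t\<close>, of "inc_mult g ?r"] diag
    by (simp add: algebra_simps)
  then show "F s t = Z s t +
      (\<Sum>w\<in>{s<..t}. ((inc_rev \<rho> g s w - [:0, 1:] * g s w) div [:-1, 1:]) * F w t)"
    by (simp only: inc_mult_reduced_kernel_right[OF fin ker g(1)] g(3))

  \<comment> \<open>Dually, \<open>K\<close> now meets \<open>?r\<close> from the left, leaving
    \<open>(g \<kappa>) f\<close>.\<close>
  have "inc_mult (inc_mult (inc_mult g \<kappa>) K) (inc_mult ?r f) =
      inc_mult (inc_mult g \<kappa>) (inc_mult (inc_mult K ?r) f)"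
    by (simp only: assoc)
  then have "inc_mult G (inc_mult ?r f) s t = - Z s t"
    by (simp add: G Z inc_mult_minus_left K inc_mult_one_left[OF fin f(1)])
  then have "G s t = Z s t + (\<Sum>w\<in>{s..<t}. G s w * inc_mult ?r f w t)"
    unfolding inc_mult_split_right[OF fin \<open>s \<le> t\<close>, of G] diag
    by (simp add: algebra_simps)
  then show "G s t = Z s t +
      (\<Sum>w\<in>{s..<t}. G s w * ((inc_rev \<rho> f w t - [:0, 1:] * f w t) div [:-1, 1:]))"
    by (simp only: inc_mult_reduced_kernel_left[OF fin ker f(1)] f(3))
qed

end
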